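(* Let $a(n)$ ($n\ge1$) and $c(k)$ ($k\ge1$) be complex numbers such that, as formal power series in $q$, \[ f=1+\sum_{n=1}^\infty a(n)q^n=\prod_{k=1}^\infty(1-q^k)^{c(k)}. \] Then for every integer $n\ge1$, \[ a(n)=\widehat F_n\big(a(1),\dots,a(n-1)\big)-\frac1n\sum_{e\mid n}c(e)\,e . \]
   Context: $(1-q^k)^{c}$ denotes the binomial series $\exp(c\log(1-q^k))$. For $n\ge1$, \[ \widehat F_n(x_1,\dots,x_{n-1})=\sum_{\substack{m_1,\dots,m_{n-1}\ge 0\\ m_1+2m_2+\cdots+(n-1)m_{n-1}=n}}(-1)^{m_1+\cdots+m_{n-1}}\frac{(m_1+\cdots+m_{n-1}-1)!}{m_1!\cdots m_{n-1}!}\,x_1^{m_1}\cdots x_{n-1}^{m_{n-1}}; \] for $n=1$ the sum is empty, so $\widehat F_1=0$. *)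

theory Defs
  imports
    "HOL-Analysis.Infinite_Products"
    "HOL-Computational_Algebra.Formal_Power_Series"
begin

text \<open>
  The formal power series \<open>(1 - q^k)^c = exp (c * log (1 - q^k))\<close>, where \<open>fps_ln 1\<close> is the
  expansion of \<open>log (1 + X)\<close> and \<open>fps_exp 1\<close> that of \<open>exp X\<close>. The compositions are meaningful
  only for \<open>k \<ge> 1\<close>, since the inner series must have zero constant term.
\<close>

definition one_minus_qpow_powr :: "nat \<Rightarrow> complex \<Rightarrow> complex fps" where
  "one_minus_qpow_powr k c =
     fps_exp 1 oo (fps_const c * (fps_ln 1 oo (- (fps_X ^ k))))"

lemma fps_exp_fps_ln_eq_binomial:
  "fps_exp 1 oo (fps_const c * fps_ln 1) = fps_binomial (c :: complex)"
proof -
  let ?E = "fps_exp 1 oo (fps_const c * fps_ln 1)"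
  have "fps_deriv ?E = (fps_const c * ?E) / (1 + fps_X)"
    by (simp add: fps_compose_deriv fps_ln_deriv fps_divide_unit mult_ac)
  moreover have "fps_nth ?E 0 = 1" by simp
  ultimately show ?thesis using fps_binomial_ODE_unique' by blast
qed

lemma one_minus_qpow_powr_eq_binomial:
  assumes "k \<ge> 1"
  shows "one_minus_qpow_powr k c = fps_binomial c oo (- (fps_X ^ k))"
proof -
  have 0: "fps_nth (- (fps_X ^ k) :: complex fps) 0 = 0" using assms by simp
  have "fps_const c * (fps_ln 1 oo (- (fps_X ^ k))) = (fps_const c * fps_ln 1) oo (- (fps_X ^ k))"
    using 0 by (simp add: fps_compose_mult_distrib)
  then show ?thesis
    using 0 by (simp add: one_minus_qpow_powr_def fps_compose_assoc
        flip: fps_exp_fps_ln_eq_binomial)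
qed

text \<open>
  The tuples \<open>(m 1, \<dots>, m (n-1))\<close> are represented by functions that are \<open>undefined\<close> outside
  \<open>{1..<n}\<close>, so that each tuple occurs exactly once.
\<close>

definition F_hat_index :: "nat \<Rightarrow> (nat \<Rightarrow> nat) set" where
  "F_hat_index n = {m \<in> {1..<n} \<rightarrow>\<^sub>E UNIV. (\<Sum>j=1..<n. j * m j) = n}"

text \<open>
  Only \<open>x 1, \<dots>, x (n-1)\<close> are used. For \<open>n \<ge> 1\<close> every index has \<open>(\<Sum>j=1..<n. m j) \<ge> 1\<close>, so
  the subtraction of naturals under the factorial does not truncate.
\<close>

definition F_hat :: "nat \<Rightarrow> (nat \<Rightarrow> complex) \<Rightarrow> complex" where
  "F_hat n x =
     (\<Sum>m\<in>F_hat_index n.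
        (-1) ^ (\<Sum>j=1..<n. m j) *
        (fact ((\<Sum>j=1..<n. m j) - 1) / (\<Prod>j=1..<n. fact (m j))) *
        (\<Prod>j=1..<n. x j ^ m j))"

lemma finite_F_hat_index: "finite (F_hat_index n)"
proof (rule finite_subset)
  show "F_hat_index n \<subseteq> {1..<n} \<rightarrow>\<^sub>E {..n}"
  proof
    fix m assume m: "m \<in> F_hat_index n"
    have "m j \<le> n" if j: "j \<in> {1..<n}" for j
    proof -
      have "m j \<le> j * m j" using j by simp
      also have "\<dots> \<le> (\<Sum>j=1..<n. j * m j)"
        using j by (intro member_le_sum) auto
      also have "\<dots> = n" using m by (simp add: F_hat_index_def)
      finally show ?thesis .
    qed
    then show "m \<in> {1..<n} \<rightarrow>\<^sub>E {..n}"
      using m by (auto simp: F_hat_index_def PiE_iff)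
  qed
qed (auto intro: finite_PiE)

lemma F_hat_1: "F_hat 1 x = 0"
  by (simp add: F_hat_def F_hat_index_def)

lemma F_hat_index_sum_pos:
  assumes "n \<ge> 1" "m \<in> F_hat_index n"
  shows "(\<Sum>j=1..<n. m j) \<ge> 1"
proof (rule ccontr)
  assume "\<not> ?thesis"
  then have "(\<Sum>j=1..<n. m j) = 0" by linarith
  then have "\<forall>j\<in>{1..<n}. m j = 0" by (simp only: sum_eq_0_iff finite_atLeastLessThan)
  then have "(\<Sum>j=1..<n. j * m j) = 0" by simp
  then show False using assms by (simp add: F_hat_index_def)
qed

end

theory Submission
  imports Defs
begin

text \<open>
  Write \<open>L = log f\<close>. The coefficient of \<open>q^n\<close> in \<open>L\<close> is computed in two ways. Expanding
  \<open>log (1 + h)\<close> with \<open>h = f - 1\<close> by the multinomial theorem gives \<open>a n - F_hat n a\<close>: the term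
  \<open>a n\<close> comes from the first power of \<open>h\<close>, and higher powers of \<open>h\<close> see only
  \<open>a 1, \<dots>, a (n - 1)\<close>. Logarithmic differentiation of the product gives
  \<open>q * L' = - (\<Sum>n. (\<Sum>e | e dvd n. c e * e) * q^n)\<close>.
\<close>

unbundle no vec_syntax \<comment> \<open>both bundles bind \<open>$\<close>\<close>
unbundle fps_syntax

section \<open>The multinomial theorem\<close>

text \<open>Makes the quotient of natural numbers in the multinomial theorem exact, so that it can
  later be read as a quotient in a field.\<close>

lemma prod_fact_dvd_fact_sum:
  assumes "finite A"
  shows "(\<Prod>j\<in>A. fact (m j)) dvd (fact (\<Sum>j\<in>A. m j) :: nat)"
  using assms
proof (induction A rule: finite_induct)
  case (insert a A)
  have "fact (m a) * (\<Prod>j\<in>A. fact (m j)) dvd (fact (m a) * fact (\<Sum>j\<in>A. m j) :: nat)"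
    using insert.IH by (rule mult_dvd_mono[OF dvd_refl])
  also have "\<dots> dvd fact (m a + (\<Sum>j\<in>A. m j))"
    by (rule fact_fact_dvd_fact)
  finally show ?case using insert.hyps by simp
qed simp

lemma finite_PiE_sum_eq:
  assumes "finite A"
  shows "finite {m \<in> A \<rightarrow>\<^sub>E (UNIV :: nat set). (\<Sum>j\<in>A. m j) = i}"
proof (rule finite_subset)
  show "{m \<in> A \<rightarrow>\<^sub>E UNIV. (\<Sum>j\<in>A. m j) = i} \<subseteq> A \<rightarrow>\<^sub>E {..i}"
    using assms by (auto simp: PiE_iff extensional_def intro: member_le_sum)
qed (use assms in \<open>auto intro: finite_PiE\<close>)

text \<open>Induction on \<open>A\<close>: the binomial theorem splits off the exponent
  \<open>k\<close> of the new element, and the binomial coefficient times the multinomial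
  coefficient for \<open>i - k\<close> is the one for \<open>i\<close>. Dividing in the naturals
  keeps the formula meaningful over any commutative semiring.\<close>

theorem multinomial_theorem:
  fixes x :: "'b \<Rightarrow> 'a :: comm_semiring_1"
  assumes "finite A"
  shows "(\<Sum>j\<in>A. x j) ^ i =
    (\<Sum>m | m \<in> A \<rightarrow>\<^sub>E UNIV \<and> (\<Sum>j\<in>A. m j) = i.
       of_nat (fact i div (\<Prod>j\<in>A. fact (m j))) * (\<Prod>j\<in>A. x j ^ m j))"
  using assms
proof (induction A arbitrary: i rule: finite_induct)
  case empty
  show ?case by (cases i) auto
next
  case (insert a A)
  define M where "M i = {m. m \<in> A \<rightarrow>\<^sub>E (UNIV :: nat set) \<and> (\<Sum>j\<in>A. m j) = i}" for i
  define M' where "M' = {m. m \<in> insert a A \<rightarrow>\<^sub>E (UNIV :: nat set) \<and> (\<Sum>j\<in>insert a A. m j) = i}"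
  have upd: "(\<Sum>j\<in>A. (m(a := k)) j) = (\<Sum>j\<in>A. m j)"
    "(\<Prod>j\<in>A. fact ((m(a := k)) j)) = (\<Prod>j\<in>A. fact (m j) :: nat)"
    "(\<Prod>j\<in>A. x j ^ (m(a := k)) j) = (\<Prod>j\<in>A. x j ^ m j)" for m k
    using insert.hyps by (auto intro!: sum.cong prod.cong)
  \<comment> \<open>A tuple on \<open>insert a A\<close> is its exponent \<open>k\<close> at
    \<open>a\<close> together with a tuple on \<open>A\<close> of total \<open>i - k\<close>. The
    inverse resets the value at \<open>a\<close> to \<open>undefined\<close>, as extensionality on
    \<open>A\<close> demands.\<close>
  have bij: "bij_betw (\<lambda>(k, m). m(a := k)) (SIGMA k:{..i}. M (i - k)) M'"
  proof (rule bij_betwI[where g = "\<lambda>m. (m a, m(a := undefined))"])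
    show "(\<lambda>(k, m). m(a := k)) \<in> (SIGMA k:{..i}. M (i - k)) \<rightarrow> M'"
      using insert.hyps by (auto simp: M_def M'_def upd simp del: fun_upd_apply)
        (auto simp: PiE_iff extensional_def split: if_splits)
    show "(\<lambda>m. (m a, m(a := undefined))) \<in> M' \<rightarrow> (SIGMA k:{..i}. M (i - k))"
      using insert.hyps by (auto simp: M_def M'_def upd simp del: fun_upd_apply)
        (auto simp: PiE_iff extensional_def split: if_splits)
    show "(\<lambda>m. (m a, m(a := undefined))) (case p of (k, m) \<Rightarrow> m(a := k)) = p"
      if "p \<in> (SIGMA k:{..i}. M (i - k))" for p
      using that insert.hyps
      by (auto simp: M_def fun_eq_iff PiE_iff extensional_def)
  qed auto
  have coeff: "(i choose k) * (fact (i - k) div (\<Prod>j\<in>A. fact (m j))) =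
      fact i div (\<Prod>j\<in>insert a A. fact ((m(a := k)) j))"
    if k: "k \<le> i" and m: "m \<in> M (i - k)" for k m
  proof -
    have dvd: "(\<Prod>j\<in>A. fact (m j)) dvd (fact (i - k) :: nat)"
      using prod_fact_dvd_fact_sum[OF insert.hyps(1), of m] m by (simp add: M_def)
    have "fact i = fact k * ((i choose k) * fact (i - k))"
      using binomial_fact_lemma[OF k] by (simp add: mult_ac)
    moreover have "(i choose k) * (fact (i - k) div (\<Prod>j\<in>A. fact (m j)))
        = ((i choose k) * fact (i - k)) div (\<Prod>j\<in>A. fact (m j))"
      using dvd by (rule div_mult_swap)
    ultimately show ?thesis
      using insert.hyps by (simp add: upd del: fun_upd_apply) simp
  qed
  have "(\<Sum>j\<in>insert a A. x j) ^ i = (x a + (\<Sum>j\<in>A. x j)) ^ i"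
    using insert.hyps by simp
  also have "\<dots> = (\<Sum>k\<le>i. of_nat (i choose k) * x a ^ k * (\<Sum>j\<in>A. x j) ^ (i - k))"
    by (rule binomial_ring)
  also have "\<dots> = (\<Sum>k\<le>i. \<Sum>m\<in>M (i - k).
      of_nat ((i choose k) * (fact (i - k) div (\<Prod>j\<in>A. fact (m j)))) *
      (x a ^ k * (\<Prod>j\<in>A. x j ^ m j)))"
    unfolding insert.IH by (simp add: M_def sum_distrib_left mult_ac)
  also have "\<dots> = (\<Sum>(k, m)\<in>(SIGMA k:{..i}. M (i - k)).
      of_nat ((i choose k) * (fact (i - k) div (\<Prod>j\<in>A. fact (m j)))) *
      (x a ^ k * (\<Prod>j\<in>A. x j ^ m j)))"
    by (rule sum.Sigma) (use insert.hyps finite_PiE_sum_eq in \<open>auto simp: M_def\<close>)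
  also have "\<dots> = (\<Sum>p\<in>(SIGMA k:{..i}. M (i - k)). (\<lambda>m.
      of_nat (fact i div (\<Prod>j\<in>insert a A. fact (m j))) * (\<Prod>j\<in>insert a A. x j ^ m j))
      (case p of (k, m) \<Rightarrow> m(a := k)))"
  proof (rule sum.cong[OF refl])
    fix p assume "p \<in> (SIGMA k:{..i}. M (i - k))"
    then obtain k m where p: "p = (k, m)" and km: "k \<le> i" "m \<in> M (i - k)" by auto
    have "(\<Prod>j\<in>insert a A. x j ^ (m(a := k)) j) = x a ^ k * (\<Prod>j\<in>A. x j ^ m j)"
      using insert.hyps by (simp add: upd del: fun_upd_apply) simp
    then show "(case p of (k, m) \<Rightarrow>
        of_nat ((i choose k) * (fact (i - k) div (\<Prod>j\<in>A. fact (m j)))) *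
        (x a ^ k * (\<Prod>j\<in>A. x j ^ m j))) =
        (\<lambda>m. of_nat (fact i div (\<Prod>j\<in>insert a A. fact (m j))) *
          (\<Prod>j\<in>insert a A. x j ^ m j)) (case p of (k, m) \<Rightarrow> m(a := k))"
      unfolding p prod.case coeff[OF km] by (simp only:)
  qed
  also have "\<dots> = (\<Sum>m\<in>M'.
      of_nat (fact i div (\<Prod>j\<in>insert a A. fact (m j))) * (\<Prod>j\<in>insert a A. x j ^ m j))"
    by (rule sum.reindex_bij_betw[OF bij])
  finally show ?case by (simp only: M'_def)
qed

section \<open>Coefficients of the logarithm\<close>

lemma fps_prod_monom_power:
  fixes x :: "nat \<Rightarrow> 'a :: comm_ring_1"
  assumes "finite A"
  shows "(\<Prod>j\<in>A. (fps_const (x j) * fps_X ^ j) ^ m j) =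
    fps_const (\<Prod>j\<in>A. x j ^ m j) * fps_X ^ (\<Sum>j\<in>A. j * m j)"
  using assms
  by (induction A rule: finite_induct)
    (simp_all add: power_mult_distrib power_add power_mult mult_ac flip: fps_const_mult fps_const_power)

text \<open>In the multinomial expansion each tuple contributes one monomial, of degree
  \<open>\<Sum>j\<in>A. j * m j\<close>, so taking a coefficient just selects the tuples of that
  weight.\<close>

lemma fps_nth_sum_monom_power:
  fixes x :: "nat \<Rightarrow> 'a :: field_char_0"
  assumes A: "finite A"
  shows "(\<Sum>j\<in>A. fps_const (x j) * fps_X ^ j) ^ i $ n =
    (\<Sum>m | m \<in> A \<rightarrow>\<^sub>E UNIV \<and> (\<Sum>j\<in>A. m j) = i \<and> (\<Sum>j\<in>A. j * m j) = n.
       fact i / (\<Prod>j\<in>A. fact (m j)) * (\<Prod>j\<in>A. x j ^ m j))"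
proof -
  have coeff: "of_nat (fact i div (\<Prod>j\<in>A. fact (m j))) = fact i / (\<Prod>j\<in>A. fact (m j) :: 'a)"
    if "(\<Sum>j\<in>A. m j) = i" for m
  proof -
    have "(\<Prod>j\<in>A. fact (m j)) dvd (fact i :: nat)"
      using prod_fact_dvd_fact_sum[OF A, of m] that by simp
    from of_nat_of_nat_div[OF this, where 'a = 'a] show ?thesis by (simp add: of_nat_prod)
  qed
  have "(\<Sum>j\<in>A. fps_const (x j) * fps_X ^ j) ^ i $ n =
    (\<Sum>m | m \<in> A \<rightarrow>\<^sub>E UNIV \<and> (\<Sum>j\<in>A. m j) = i.
       if (\<Sum>j\<in>A. j * m j) = n then of_nat (fact i div (\<Prod>j\<in>A. fact (m j))) * (\<Prod>j\<in>A. x j ^ m j)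
       else 0)"
    unfolding multinomial_theorem[OF A] fps_sum_nth
    by (intro sum.cong refl)
      (auto simp: fps_prod_monom_power[OF A] fps_of_nat[symmetric] simp del: of_nat_fact)
  also have "\<dots> = (\<Sum>m | m \<in> A \<rightarrow>\<^sub>E UNIV \<and> (\<Sum>j\<in>A. m j) = i \<and> (\<Sum>j\<in>A. j * m j) = n.
       of_nat (fact i div (\<Prod>j\<in>A. fact (m j))) * (\<Prod>j\<in>A. x j ^ m j))"
    by (rule sum.mono_neutral_cong_right) (use finite_PiE_sum_eq[OF A] in auto)
  also have "\<dots> = (\<Sum>m | m \<in> A \<rightarrow>\<^sub>E UNIV \<and> (\<Sum>j\<in>A. m j) = i \<and> (\<Sum>j\<in>A. j * m j) = n.
       fact i / (\<Prod>j\<in>A. fact (m j)) * (\<Prod>j\<in>A. x j ^ m j))"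
    by (intro sum.cong refl) (simp add: coeff)
  finally show ?thesis .
qed

text \<open>The difference \<open>g ^ i - h ^ i\<close> is \<open>g - h\<close>, a multiple of
  \<open>fps_X ^ n\<close>, times a sum of products of \<open>i - 1\<close> factors \<open>g\<close>
  or \<open>h\<close>. As \<open>i - 1\<close> is positive, that sum has zero constant term, so the
  difference starts beyond degree \<open>n\<close>.\<close>

lemma fps_power_nth_cong_below:
  fixes g h :: "'a :: comm_ring_1 fps"
  assumes "g $ 0 = 0" "h $ 0 = 0" "\<And>j. j < n \<Longrightarrow> g $ j = h $ j" "i \<ge> 2"
  shows "g ^ i $ n = h ^ i $ n"
proof -
  define R where "R = fps_shift n (g - h)"
  have R: "g - h = fps_X ^ n * R"
    by (rule fps_ext) (use assms(3) in \<open>auto simp: R_def fps_X_power_mult_nth\<close>)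
  have "(\<Sum>p<i. h ^ (i - Suc p) * g ^ p) $ 0 = (\<Sum>p<i. 0 ^ (i - Suc p) * 0 ^ p)"
    using assms(1,2) by (simp add: fps_sum_nth fps_nth_power_0)
  also have "\<dots> = 0"
    using \<open>i \<ge> 2\<close> by (intro sum.neutral) (auto simp: power_0_left)
  finally have "(g ^ i - h ^ i) $ n = 0"
    by (simp add: power_diff_sumr2[of g] R mult.assoc fps_X_power_mult_nth)
  then show ?thesis by simp
qed

text \<open>Group the tuples by their total \<open>i\<close>. The logarithm coefficient
  \<open>(-1) ^ (i - 1) / i\<close> turns the multinomial numerator \<open>fact i\<close> into
  \<open>fact (i - 1)\<close>, which is the weight in \<open>F_hat\<close> up to sign.\<close>

lemma F_hat_eq_fps_ln_nth:
  assumes n: "n \<ge> 1"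
  shows "F_hat n x = - (fps_ln 1 oo (\<Sum>j=1..<n. fps_const (x j) * fps_X ^ j)) $ n"
proof -
  let ?t = "\<lambda>m. (-1) ^ (\<Sum>j=1..<n. m j) *
        (fact ((\<Sum>j=1..<n. m j) - 1) / (\<Prod>j=1..<n. fact (m j))) *
        (\<Prod>j=1..<n. x j ^ m j) :: complex"
  let ?I = "\<lambda>i. {m \<in> F_hat_index n. (\<Sum>j=1..<n. m j) = i}"
  have I: "?I i = {m. m \<in> {1..<n} \<rightarrow>\<^sub>E UNIV \<and> (\<Sum>j=1..<n. m j) = i \<and> (\<Sum>j=1..<n. j * m j) = n}" for i
    by (auto simp: F_hat_index_def)
  have "F_hat n x = (\<Sum>i=0..n. \<Sum>m\<in>?I i. ?t m)"
    unfolding F_hat_def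
  proof (rule sum.group[symmetric])
    show "(\<lambda>m. \<Sum>j=1..<n. m j) ` F_hat_index n \<subseteq> {0..n}"
    proof clarsimp
      fix m assume "m \<in> F_hat_index n"
      then have "(\<Sum>j=1..<n. j * m j) = n" by (simp add: F_hat_index_def)
      moreover have "(\<Sum>j=1..<n. m j) \<le> (\<Sum>j=1..<n. j * m j)"
        by (rule sum_mono) auto
      ultimately show "(\<Sum>j=Suc 0..<n. m j) \<le> n" by simp
    qed
  qed (use finite_F_hat_index in auto)
  also have "\<dots> = (\<Sum>i=0..n. - (fps_ln 1 $ i * (\<Sum>j=1..<n. fps_const (x j) * fps_X ^ j) ^ i $ n))"
  proof (rule sum.cong[OF refl])
    fix i
    show "(\<Sum>m\<in>?I i. ?t m) =
      - (fps_ln 1 $ i * (\<Sum>j=1..<n. fps_const (x j) * fps_X ^ j) ^ i $ n)"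
    proof (cases i)
      case 0
      \<comment> \<open>No index tuple has total 0, in agreement with the zero constant term of
        \<open>fps_ln 1\<close>.\<close>
      then have "?I i = {}" using F_hat_index_sum_pos[OF n] by fastforce
      then show ?thesis using 0 by (simp only: sum.empty) simp
    next
      case (Suc k)
      have "fps_ln 1 $ i * (fact i / p * y) = - ((-1) ^ i * (fact (i - 1) / p) * y)"
        for p y :: complex
        using Suc by (simp add: fps_ln_nth field_simps del: of_nat_Suc)
      then show ?thesis
        unfolding fps_nth_sum_monom_power[OF finite_atLeastLessThan] I sum_distrib_left
          sum_negf[symmetric]
        by (intro sum.cong refl) auto
    qed
  qed
  also have "\<dots> = - (fps_ln 1 oo (\<Sum>j=1..<n. fps_const (x j) * fps_X ^ j)) $ n"
    by (simp add: fps_compose_nth sum_negf)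
  finally show ?thesis .
qed

text \<open>Truncate \<open>h\<close> below degree \<open>n\<close>. At degree \<open>n\<close> the
  powers with exponent at least 2 do not notice the truncation, while the first power loses exactly
  \<open>h $ n\<close>; the truncated series yields \<open>- F_hat\<close>.\<close>

lemma fps_ln_compose_nth_eq_F_hat:
  assumes n: "n \<ge> 1" and h: "h $ 0 = 0"
  shows "(fps_ln 1 oo h) $ n = h $ n - F_hat n (fps_nth h)"
proof -
  define T where "T = (\<Sum>j=1..<n. fps_const (h $ j) * fps_X ^ j)"
  have T: "T $ k = (if 1 \<le> k \<and> k < n then h $ k else 0)" for k
    by (auto simp: T_def fps_sum_nth if_distrib[of "\<lambda>y. _ * y"] cong: if_cong)
  have pow: "h ^ i $ n = T ^ i $ n" if "i \<ge> 2" for i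
  proof (rule fps_power_nth_cong_below[OF h _ _ that])
    show "h $ j = T $ j" if "j < n" for j using that h by (cases j) (auto simp: T)
  qed (simp add: T)
  have "(fps_ln 1 oo h) $ n - (fps_ln 1 oo T) $ n =
      (\<Sum>i=0..n. fps_ln 1 $ i * (h ^ i $ n - T ^ i $ n))"
    by (simp add: fps_compose_nth sum_subtractf algebra_simps)
  also have "\<dots> = (\<Sum>i\<in>{1}. fps_ln 1 $ i * (h ^ i $ n - T ^ i $ n))"
  proof (rule sum.mono_neutral_right)
    show "\<forall>i\<in>{0..n} - {1}. fps_ln 1 $ i * (h ^ i $ n - T ^ i $ n) = 0"
    proof
      fix i assume "i \<in> {0..n} - {1}"
      then have "i = 0 \<or> i \<ge> 2" by auto
      then show "fps_ln 1 $ i * (h ^ i $ n - T ^ i $ n) = 0" using pow[of i] by auto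
    qed
  qed (use n in auto)
  also have "\<dots> = h $ n"
    using n by (simp add: fps_ln_nth T)
  finally show ?thesis
    using F_hat_eq_fps_ln_nth[OF n, of "fps_nth h"]
    unfolding T_def by (simp only: diff_eq_eq) simp
qed

section \<open>Logarithmic differentiation of the product\<close>

text \<open>The chain rule for \<open>log (1 + h)\<close> with the denominator cleared: compose
  \<open>(1 + X) * log' = 1\<close> with \<open>h\<close>.\<close>

lemma fps_deriv_fps_ln_compose:
  fixes h :: "'a :: field_char_0 fps"
  assumes "h $ 0 = 0"
  shows "(1 + h) * fps_deriv (fps_ln 1 oo h) = fps_deriv h"
proof -
  have "(1 + fps_X) * fps_deriv (fps_ln 1) = (1 :: 'a fps)"
    by (simp add: fps_ln_deriv inverse_mult_eq_1')
  then have "((1 + fps_X) * fps_deriv (fps_ln 1 :: 'a fps)) oo h = 1"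
    by simp
  then have "(1 + h) * (fps_deriv (fps_ln 1) oo h) = 1"
    using assms by (simp add: fps_compose_mult_distrib fps_compose_add_distrib)
  then show ?thesis
    using assms by (simp add: fps_compose_deriv flip: mult.assoc)
qed

text \<open>The geometric series for \<open>X^k / (1 - X^k)\<close>, with the denominator
  cleared.\<close>

lemma one_minus_X_power_mult_multiples:
  fixes k :: nat
  assumes "k \<ge> 1"
  shows "(1 - fps_X ^ k) * Abs_fps (\<lambda>n. if n \<ge> 1 \<and> k dvd n then 1 else 0) =
    (fps_X ^ k :: 'a :: comm_ring_1 fps)"
  by (rule fps_ext)
    (use assms in \<open>auto simp: ring_distribs fps_X_power_mult_nth dvd_minus_self dest: dvd_imp_le\<close>)

text \<open>The operator \<open>X * d/dX\<close> sends \<open>c * log (1 - X^k)\<close> to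
  \<open>- c * k * X^k / (1 - X^k)\<close>, and the geometric series spreads this over the positive
  multiples of \<open>k\<close>.\<close>

lemma X_deriv_one_minus_qpow_powr:
  assumes k: "k \<ge> 1"
  shows "fps_X * fps_deriv (one_minus_qpow_powr k c) =
    one_minus_qpow_powr k c *
      Abs_fps (\<lambda>n. if n \<ge> 1 \<and> k dvd n then - (c * of_nat k) else 0)"
proof -
  let ?l = "fps_ln 1 oo (- (fps_X ^ k)) :: complex fps"
  let ?G = "Abs_fps (\<lambda>n. if n \<ge> 1 \<and> k dvd n then 1 else 0) :: complex fps"
  have nz: "(1 - fps_X ^ k :: complex fps) \<noteq> 0"
    using k by (metis fps_X_power_nth fps_sub_nth fps_one_nth fps_zero_nth diff_0_right
        not_one_le_zero zero_neq_one)
  have "(1 - fps_X ^ k) * (fps_X * fps_deriv ?l) = fps_X * fps_deriv (- (fps_X ^ k))"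
    using fps_deriv_fps_ln_compose[of "- (fps_X ^ k) :: complex fps"] k
    by (simp add: mult.left_commute[of _ fps_X])
  also have "\<dots> = - fps_const (of_nat k) * fps_X ^ k"
    by (rule fps_ext) (simp add: fps_mult_fps_X_deriv_shift mult.assoc flip: fps_const_neg)
  also have "\<dots> = (1 - fps_X ^ k) * (- fps_const (of_nat k) * ?G)"
    using one_minus_X_power_mult_multiples[OF k, where 'a = complex]
    by (metis mult.left_commute)
  finally have l: "fps_X * fps_deriv ?l = - fps_const (of_nat k) * ?G"
    using nz by (simp only: mult_cancel_left) simp
  have "fps_X * fps_deriv (one_minus_qpow_powr k c) =
      one_minus_qpow_powr k c * (fps_const c * (fps_X * fps_deriv ?l))"
    using k by (simp add: one_minus_qpow_powr_def fps_compose_deriv mult_ac)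
  also have "fps_const c * (fps_X * fps_deriv ?l) =
      Abs_fps (\<lambda>n. if n \<ge> 1 \<and> k dvd n then - (c * of_nat k) else 0)"
    unfolding l by (rule fps_ext) (simp add: mult.assoc)
  finally show ?thesis .
qed

text \<open>Logarithmic derivatives add up over a product; this is the Leibniz rule in a form free
  of division.\<close>

lemma X_deriv_prod_fps:
  fixes g D :: "'b \<Rightarrow> 'a :: comm_ring_1 fps"
  assumes "finite A" "\<And>k. k \<in> A \<Longrightarrow> fps_X * fps_deriv (g k) = g k * D k"
  shows "fps_X * fps_deriv (\<Prod>k\<in>A. g k) = (\<Prod>k\<in>A. g k) * (\<Sum>k\<in>A. D k)"
  using assms
proof (induction A rule: finite_induct)
  case (insert k A)
  have "fps_X * fps_deriv (g k * (\<Prod>k\<in>A. g k)) =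
      (fps_X * fps_deriv (g k)) * (\<Prod>k\<in>A. g k) + g k * (fps_X * fps_deriv (\<Prod>k\<in>A. g k))"
    by (simp add: algebra_simps)
  also have "\<dots> = g k * (\<Prod>k\<in>A. g k) * (D k + (\<Sum>k\<in>A. D k))"
    using insert by (simp add: algebra_simps)
  finally show ?case using insert.hyps by simp
qed simp

text \<open>Convergence of formal power series makes each coefficient eventually constant, so the
  identity at degree \<open>n\<close> can be checked on one sufficiently long partial
  product.\<close>

lemma X_deriv_has_prod:
  fixes f :: "complex fps"
  assumes f: "(\<lambda>k. one_minus_qpow_powr (Suc k) (c (Suc k))) has_prod f" and nz: "f \<noteq> 0"
  shows "fps_X * fps_deriv f =
    f * Abs_fps (\<lambda>n. if n = 0 then 0 else - (\<Sum>e | e dvd n. c e * of_nat e))"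
proof (rule fps_ext)
  fix n
  define D where "D = Abs_fps (\<lambda>n. if n = 0 then 0 else - (\<Sum>e | e dvd n. c e * of_nat e))"
  define P where "P N = (\<Prod>k\<le>N. one_minus_qpow_powr (Suc k) (c (Suc k)))" for N
  define S where "S N = (\<Sum>k\<le>N.
    Abs_fps (\<lambda>n. if n \<ge> 1 \<and> Suc k dvd n then - (c (Suc k) * of_nat (Suc k)) else 0))" for N
  \<comment> \<open>A product equal to 0 may arise from a vanishing factor;
    \<open>f \<noteq> 0\<close> leaves the case where the partial products from index 0 tend to
    \<open>f\<close>.\<close>
  have lim: "P \<longlonglongrightarrow> f"
    using f nz by (auto simp: has_prod_def raw_has_prod_def P_def[abs_def])
  have "\<forall>\<^sub>F N in sequentially. \<forall>j\<in>{..n}. P N $ j = f $ j"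
    using lim by (intro eventually_ball_finite) (auto simp: tendsto_fps_iff)
  then have "\<forall>\<^sub>F N in sequentially. (\<forall>j\<in>{..n}. P N $ j = f $ j) \<and> N \<ge> n"
    using eventually_ge_at_top by (rule eventually_conj)
  \<comment> \<open>The bound \<open>N \<ge> n\<close> ensures that every divisor \<open>e\<close>
    of a positive \<open>j \<le> n\<close> occurs as \<open>Suc k\<close> with
    \<open>k \<le> N\<close>.\<close>
  then obtain N where N: "\<And>j. j \<le> n \<Longrightarrow> P N $ j = f $ j" "N \<ge> n"
    unfolding eventually_sequentially by auto
  have S: "S N $ j = D $ j" if "j \<le> n" for j
  proof (cases "j = 0")
    case False
    have "S N $ j = (\<Sum>k\<le>N. if Suc k dvd j then - (c (Suc k) * of_nat (Suc k)) else 0)"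
      using False by (simp add: S_def fps_sum_nth)
    also have "\<dots> = (\<Sum>e\<in>Suc ` {..N}. if e dvd j then - (c e * of_nat e) else 0)"
      by (simp add: sum.reindex)
    also have "\<dots> = (\<Sum>e | e dvd j. - (c e * of_nat e))"
    proof (rule sum.mono_neutral_cong_right)
      show "{e. e dvd j} \<subseteq> Suc ` {..N}"
      proof
        fix e assume "e \<in> {e. e dvd j}"
        then have "e dvd j" by simp
        then have "e > 0" "e \<le> j" using False by (auto intro: dvd_imp_le Nat.gr0I)
        then have "e = Suc (e - 1)" "e - 1 \<in> {..N}" using that N(2) by auto
        then show "e \<in> Suc ` {..N}" by (rule image_eqI)
      qed
    qed auto
    finally show ?thesis using False by (simp add: D_def sum_negf)
  qed (simp add: S_def D_def fps_sum_nth)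
  \<comment> \<open>The factor \<open>fps_X\<close> undoes the index shift of the derivative, so
    agreement up to degree \<open>n\<close> suffices.\<close>
  have "(fps_X * fps_deriv f) $ n = (fps_X * fps_deriv (P N)) $ n"
    using N(1)[of n] by (cases n) auto
  also have "fps_X * fps_deriv (P N) = P N * S N"
    unfolding P_def S_def by (intro X_deriv_prod_fps X_deriv_one_minus_qpow_powr) auto
  also have "(P N * S N) $ n = (f * D) $ n"
    unfolding fps_mult_nth by (intro sum.cong refl) (simp add: N S)
  finally show "(fps_X * fps_deriv f) $ n = (f * D) $ n" .
qed

lemma F_hat_cong:
  assumes "\<And>j. 1 \<le> j \<Longrightarrow> j < n \<Longrightarrow> x j = y j"
  shows "F_hat n x = F_hat n y"
  using assms by (simp add: F_hat_def)

theorem theorem2p1: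
  fixes a c :: "nat \<Rightarrow> complex" and f :: "complex fps" and n :: nat
  assumes f_def: "f = Abs_fps (\<lambda>n. if n = 0 then 1 else a n)"
    and f_prod: "(\<lambda>k. one_minus_qpow_powr (Suc k) (c (Suc k))) has_prod f"
    and n: "n \<ge> 1"
  shows "a n = F_hat n a - 1 / of_nat n * (\<Sum>e | e dvd n. c e * of_nat e)"
proof -
  define L where "L = fps_ln 1 oo (f - 1)"
  define D where "D = Abs_fps (\<lambda>n. if n = 0 then 0 else - (\<Sum>e | e dvd n. c e * of_nat e))"
  have f0: "f $ 0 = 1" and nz: "f \<noteq> 0"
    by (auto simp: f_def fps_eq_iff intro!: exI[of _ 0])
  have "f * (fps_X * fps_deriv L) = fps_X * fps_deriv f"
    using fps_deriv_fps_ln_compose[of "f - 1"] f0 by (simp add: L_def mult.left_commute)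
  also have "\<dots> = f * D"
    unfolding D_def by (rule X_deriv_has_prod[OF f_prod nz])
  finally have "fps_X * fps_deriv L = D"
    using nz by simp
  then have "(fps_X * fps_deriv L) $ n = D $ n" by simp
  then have "of_nat n * L $ n = - (\<Sum>e | e dvd n. c e * of_nat e)"
    using n by (simp add: D_def)
  moreover have "L $ n = a n - F_hat n a"
  proof -
    \<comment> \<open>The two sequences may differ at index 0, which \<open>F_hat\<close> never
      reads.\<close>
    have "F_hat n (fps_nth (f - 1)) = F_hat n a"
      by (rule F_hat_cong) (simp add: f_def)
    then show ?thesis
      using fps_ln_compose_nth_eq_F_hat[OF n, of "f - 1"] f0 n by (simp add: L_def f_def)
  qed
  ultimately show ?thesis
    using n by (simp add: field_simps)
qed

end
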